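(* Let $B_n$ be the braid group on $n$ strands with Artin generators $\sigma_i$, $1\le i\le n-1$, and let $\mathbb{Z}[t^{\pm1},b^{\pm1}]$ be the ring of Laurent polynomials in two variables over $\mathbb{Z}$. Let $\Psi:B_n\to GL_n(\mathbb{Z}[t^{\pm1},b^{\pm1}])$ be the representation defined by $$\Psi(\sigma_i)=I_{i-1}\oplus\begin{pmatrix}0&t\\ b&0\end{pmatrix}\oplus I_{n-i-1},\qquad 1\le i\le n-1.$$ Then the kernel of $\Psi$ is not trivial; hence the representation $\Psi$ is not faithful. Examples: in $B_3$, the braid $\sigma_1\sigma_2^{-1}\sigma_1\sigma_2^{-1}\sigma_1\sigma_2^{-1}$ is non-trivial and lies in the kernel; in $B_3$, with $\alpha=\sigma_1^{-1}\sigma_2^{2}\sigma_1^{-1}\sigma_2^{-1}\sigma_1^{2}\sigma_2^{-1}$ and $\beta=\sigma_2^{-1}\sigma_1^{2}\sigma_2^{-1}\sigma_1^{-1}\sigma_2^{2}\sigma_1^{-1}$, the braid $\alpha\beta^{-1}$ is non-trivial and lies in the kernel; in $B_4$, the braid $\sigma_1^{2}\sigma_3^{2}\sigma_2\sigma_3^{-2}\sigma_1^{-2}\sigma_2^{-1}$ is non-trivial and lies in the kernel.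
   Context: The braid group $B_n$ is generated by $\sigma_1,\dots,\sigma_{n-1}$ subject to $\sigma_i\sigma_{i+1}\sigma_i=\sigma_{i+1}\sigma_i\sigma_{i+1}$ for $1\le i\le n-2$ and $\sigma_i\sigma_j=\sigma_j\sigma_i$ for $|i-j|\ge 2$. $I_k$ denotes the $k\times k$ identity matrix and $\oplus$ the block-diagonal sum of matrices. The given assignment extends to a group homomorphism on $B_n$. Faithful means injective.
   Formalization: The general claim is stated for n ≥ 3: for n = 1 the braid group is trivial, and for n = 2 it is infinite cyclic with Ψ(σ_1)^{2k} = (tb)^k I and odd powers antidiagonal, so Ψ is injective and the claim fails. *)

theory Defs
  imports
    "HOL-Library.Poly_Mapping"
    "HOL-Library.Product_Plus"
    "HOL-Algebra.Coset"
    "Jordan_Normal_Form.Matrix"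
begin

section \<open>The braid group\<close>

text \<open>
  A letter \<open>(i, True)\<close> stands for \<open>\<sigma>\<^sub>i\<close>, a letter \<open>(i, False)\<close> for its inverse. The group \<open>B\<^sub>n\<close> is
  the set of words in \<open>\<sigma>\<^sub>1, \<dots>, \<sigma>\<^sub>n\<^sub>-\<^sub>1\<close> and their formal inverses, modulo the least congruence that
  contains free cancellation and the braid relations.
\<close>

type_synonym braid_word = "(nat \<times> bool) list"

definition braid_words :: "nat \<Rightarrow> braid_word set" where
  "braid_words n = lists ({1..<n} \<times> UNIV)"

inductive braid_eq :: "nat \<Rightarrow> braid_word \<Rightarrow> braid_word \<Rightarrow> bool" for n :: nat where
  refl: "w \<in> braid_words n \<Longrightarrow> braid_eq n w w"
| sym: "braid_eq n v w \<Longrightarrow> braid_eq n w v"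
| trans: "braid_eq n u v \<Longrightarrow> braid_eq n v w \<Longrightarrow> braid_eq n u w"
| append: "braid_eq n u u' \<Longrightarrow> braid_eq n v v' \<Longrightarrow> braid_eq n (u @ v) (u' @ v')"
| cancel: "i \<in> {1..<n} \<Longrightarrow> braid_eq n [(i, e), (i, \<not> e)] []"
| braid: "i \<in> {1..<n} \<Longrightarrow> i + 1 \<in> {1..<n} \<Longrightarrow>
    braid_eq n [(i, True), (i + 1, True), (i, True)] [(i + 1, True), (i, True), (i + 1, True)]"
| commute: "i \<in> {1..<n} \<Longrightarrow> j \<in> {1..<n} \<Longrightarrow> \<bar>int i - int j\<bar> \<ge> 2 \<Longrightarrow>
    braid_eq n [(i, True), (j, True)] [(j, True), (i, True)]"

definition braid_rel :: "nat \<Rightarrow> (braid_word \<times> braid_word) set" where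
  "braid_rel n = {(v, w). braid_eq n v w}"

definition braid_group :: "nat \<Rightarrow> braid_word set monoid" where
  "braid_group n = \<lparr>
     carrier = braid_words n // braid_rel n,
     monoid.mult = (\<lambda>X Y. \<Union>u\<in>X. \<Union>v\<in>Y. braid_rel n `` {u @ v}),
     one = braid_rel n `` {[]}\<rparr>"

definition sigma :: "nat \<Rightarrow> nat \<Rightarrow> braid_word set" where
  "sigma n i = braid_rel n `` {[(i, True)]}"


section \<open>The representation\<close>

text \<open>
  The ring \<open>\<int>[t\<^sup>\<plusminus>\<^sup>1, b\<^sup>\<plusminus>\<^sup>1]\<close> is the group ring of \<open>\<int> \<times> \<int>\<close>: the exponent pair \<open>(j, k)\<close> stands for the
  monomial with exponent \<open>j\<close> in \<open>t\<close> and \<open>k\<close> in \<open>b\<close>.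
\<close>

type_synonym laurent = "(int \<times> int) \<Rightarrow>\<^sub>0 int"

definition var_t :: laurent where "var_t = Poly_Mapping.single (1, 0) 1"
definition var_b :: laurent where "var_b = Poly_Mapping.single (0, 1) 1"

definition GL :: "nat \<Rightarrow> laurent mat monoid" where
  "GL n = units_of (ring_mat TYPE(laurent) n ())"

definition Psi_gen :: "nat \<Rightarrow> nat \<Rightarrow> laurent mat" where
  "Psi_gen n i = diag_block_mat
     [1\<^sub>m (i - 1), mat_of_rows_list 2 [[0, var_t], [var_b, 0]], 1\<^sub>m (n - i - 1)]"

definition Psi_letter :: "nat \<Rightarrow> nat \<times> bool \<Rightarrow> laurent mat" where
  "Psi_letter n = (\<lambda>(i, e). if e then Psi_gen n i else inv\<^bsub>GL n\<^esub> (Psi_gen n i))"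

definition Psi_word :: "nat \<Rightarrow> braid_word \<Rightarrow> laurent mat" where
  "Psi_word n w = foldr (\<lambda>l M. Psi_letter n l \<otimes>\<^bsub>GL n\<^esub> M) w \<one>\<^bsub>GL n\<^esub>"

text \<open>
  The value of \<open>Psi n\<close> on a braid is the common value of \<open>Psi_word n\<close> on all words representing it.
  That this value exists, and that \<open>Psi n\<close> is therefore the homomorphism extending \<open>Psi_gen n\<close>, is
  shown in \<open>Psi_hom\<close> and \<open>Psi_sigma\<close> below.
\<close>

definition Psi :: "nat \<Rightarrow> braid_word set \<Rightarrow> laurent mat" where
  "Psi n X = the_elem (Psi_word n ` X)"


section \<open>The braid group is a group\<close>

lemma braid_eq_words: "braid_eq n v w \<Longrightarrow> v \<in> braid_words n \<and> w \<in> braid_words n"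
  by (induction rule: braid_eq.induct) (auto simp: braid_words_def)

lemma equiv_braid_rel: "equiv (braid_words n) (braid_rel n)"
proof (rule equivI)
  show "braid_rel n \<subseteq> braid_words n \<times> braid_words n"
    using braid_eq_words by (auto simp: braid_rel_def)
  show "refl_on (braid_words n) (braid_rel n)"
    using braid_eq_words by (auto simp: refl_on_def braid_rel_def intro: braid_eq.refl)
  show "sym_on UNIV (braid_rel n)"
    by (auto simp: sym_on_def braid_rel_def intro: braid_eq.sym)
  show "trans_on UNIV (braid_rel n)"
    by (auto simp: trans_on_def braid_rel_def intro: braid_eq.trans)
qed

lemma braid_class_eq_iff:
  assumes "v \<in> braid_words n" "w \<in> braid_words n"
  shows "braid_rel n `` {v} = braid_rel n `` {w} \<longleftrightarrow> braid_eq n v w"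
  using eq_equiv_class_iff[OF equiv_braid_rel assms] by (auto simp: braid_rel_def)

lemma carrier_braid_group:
  "carrier (braid_group n) = {braid_rel n `` {w} | w. w \<in> braid_words n}"
  by (auto simp: braid_group_def quotient_def)

lemma one_braid_group: "\<one>\<^bsub>braid_group n\<^esub> = braid_rel n `` {[]}"
  by (simp add: braid_group_def)

lemma mult_braid_group:
  assumes "u \<in> braid_words n" "v \<in> braid_words n"
  shows "braid_rel n `` {u} \<otimes>\<^bsub>braid_group n\<^esub> braid_rel n `` {v} = braid_rel n `` {u @ v}"
proof -
  have "congruent2 (braid_rel n) (braid_rel n) (\<lambda>u v. braid_rel n `` {u @ v})"
  proof (rule congruent2I')
    fix u u' v v'
    assume "(u, u') \<in> braid_rel n" "(v, v') \<in> braid_rel n"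
    hence "braid_eq n (u @ v) (u' @ v')"
      by (auto simp: braid_rel_def intro: braid_eq.append)
    thus "braid_rel n `` {u @ v} = braid_rel n `` {u' @ v'}"
      using braid_class_eq_iff braid_eq_words by blast
  qed
  from UN_equiv_class2[OF equiv_braid_rel equiv_braid_rel this assms]
  show ?thesis by (simp add: braid_group_def)
qed

lemma braid_words_append [simp]:
  "u @ v \<in> braid_words n \<longleftrightarrow> u \<in> braid_words n \<and> v \<in> braid_words n"
  by (auto simp: braid_words_def)

lemma braid_words_Nil [simp]: "[] \<in> braid_words n"
  by (simp add: braid_words_def)

definition inv_word :: "braid_word \<Rightarrow> braid_word" where
  "inv_word w = rev (map (\<lambda>(i, e). (i, \<not> e)) w)"

lemma inv_word_words: "w \<in> braid_words n \<Longrightarrow> inv_word w \<in> braid_words n"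
  by (fastforce simp: inv_word_def braid_words_def)

lemma inv_word_left:
  "w \<in> braid_words n \<Longrightarrow> braid_eq n (inv_word w @ w) []"
proof (induction w)
  case Nil
  show ?case by (auto simp: inv_word_def intro: braid_eq.refl)
next
  case (Cons l w)
  obtain i e where l: "l = (i, e)" by force
  have i: "i \<in> {1..<n}" and w: "w \<in> braid_words n"
    using Cons.prems by (auto simp: braid_words_def l)
  have "braid_eq n (inv_word w @ ([(i, \<not> e), (i, \<not> \<not> e)] @ w)) (inv_word w @ ([] @ w))"
    using i w by (intro braid_eq.append braid_eq.refl braid_eq.cancel inv_word_words)
  hence "braid_eq n (inv_word (l # w) @ (l # w)) (inv_word w @ w)"
    by (simp add: inv_word_def l)
  thus ?case using Cons.IH[OF w] braid_eq.trans by blast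
qed

lemma group_braid_group: "group (braid_group n)"
proof (rule groupI)
  fix X assume "X \<in> carrier (braid_group n)"
  then obtain w where w: "X = braid_rel n `` {w}" "w \<in> braid_words n"
    by (auto simp: carrier_braid_group)
  show "\<one>\<^bsub>braid_group n\<^esub> \<otimes>\<^bsub>braid_group n\<^esub> X = X"
    using w by (simp add: one_braid_group mult_braid_group)
  show "\<exists>Y\<in>carrier (braid_group n). Y \<otimes>\<^bsub>braid_group n\<^esub> X = \<one>\<^bsub>braid_group n\<^esub>"
  proof (rule bexI)
    show "braid_rel n `` {inv_word w} \<otimes>\<^bsub>braid_group n\<^esub> X = \<one>\<^bsub>braid_group n\<^esub>"
      using w inv_word_words[OF w(2)] inv_word_left[OF w(2)]
      by (simp add: one_braid_group mult_braid_group braid_class_eq_iff)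
    show "braid_rel n `` {inv_word w} \<in> carrier (braid_group n)"
      using inv_word_words[OF w(2)] by (auto simp: carrier_braid_group)
  qed
next
  fix X Y assume "X \<in> carrier (braid_group n)" "Y \<in> carrier (braid_group n)"
  then obtain v w where vw: "X = braid_rel n `` {v}" "v \<in> braid_words n"
      "Y = braid_rel n `` {w}" "w \<in> braid_words n"
    unfolding carrier_braid_group by blast
  have "v @ w \<in> braid_words n" using vw by simp
  thus "X \<otimes>\<^bsub>braid_group n\<^esub> Y \<in> carrier (braid_group n)"
    unfolding vw mult_braid_group[OF vw(2,4)] carrier_braid_group by blast
next
  show "\<one>\<^bsub>braid_group n\<^esub> \<in> carrier (braid_group n)"
    unfolding one_braid_group carrier_braid_group using braid_words_Nil by blast
next
  fix X Y Z
  assume "X \<in> carrier (braid_group n)" "Y \<in> carrier (braid_group n)" "Z \<in> carrier (braid_group n)"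
  then obtain u v w where "X = braid_rel n `` {u}" "u \<in> braid_words n"
      "Y = braid_rel n `` {v}" "v \<in> braid_words n" "Z = braid_rel n `` {w}" "w \<in> braid_words n"
    unfolding carrier_braid_group by blast
  thus "X \<otimes>\<^bsub>braid_group n\<^esub> Y \<otimes>\<^bsub>braid_group n\<^esub> Z =
      X \<otimes>\<^bsub>braid_group n\<^esub> (Y \<otimes>\<^bsub>braid_group n\<^esub> Z)"
    by (simp add: mult_braid_group)
qed

lemma sigma_carrier: "i \<in> {1..<n} \<Longrightarrow> sigma n i \<in> carrier (braid_group n)"
  by (auto simp: sigma_def carrier_braid_group braid_words_def)


section \<open>The assignment extends to a homomorphism\<close>

definition mono_mat :: "nat \<Rightarrow> (nat \<Rightarrow> nat) \<Rightarrow> (nat \<Rightarrow> laurent) \<Rightarrow> laurent mat" where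
  "mono_mat n p f = mat n n (\<lambda>(r, c). if c = p r then f r else 0)"

lemma mono_mat_mult:
  assumes "\<forall>r<n. p r < n"
  shows "mono_mat n p f * mono_mat n q g = mono_mat n (q \<circ> p) (\<lambda>r. f r * g (p r))"
proof (rule eq_matI)
  fix r c assume "r < dim_row (mono_mat n (q \<circ> p) (\<lambda>r. f r * g (p r)))"
    "c < dim_col (mono_mat n (q \<circ> p) (\<lambda>r. f r * g (p r)))"
  hence rc: "r < n" "c < n" by (auto simp: mono_mat_def)
  have "(mono_mat n p f * mono_mat n q g) $$ (r, c) =
      (\<Sum>k\<in>{0..<n}. (if k = p r then f r else 0) * (if c = q k then g k else 0))"
    using rc by (simp add: mono_mat_def scalar_prod_def)
  also have "\<dots> = (\<Sum>k\<in>{0..<n}. if k = p r then f r * (if c = q k then g k else 0) else 0)"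
    by (intro sum.cong) auto
  also have "\<dots> = f r * (if c = q (p r) then g (p r) else 0)"
    using assms rc(1) by simp
  finally show "(mono_mat n p f * mono_mat n q g) $$ (r, c) =
      mono_mat n (q \<circ> p) (\<lambda>r. f r * g (p r)) $$ (r, c)"
    using rc by (simp add: mono_mat_def)
qed (auto simp: mono_mat_def)

lemma mono_mat_cong:
  "(\<And>r. r < n \<Longrightarrow> p r = q r) \<Longrightarrow> (\<And>r. r < n \<Longrightarrow> f r = g r) \<Longrightarrow>
    mono_mat n p f = mono_mat n q g"
  by (auto simp: mono_mat_def intro!: eq_matI)

lemma mono_mat_one: "mono_mat n (\<lambda>r. r) (\<lambda>_. 1) = 1\<^sub>m n"
  by (auto simp: mono_mat_def intro!: eq_matI)

lemma mono_mat_carrier: "mono_mat n p f \<in> carrier_mat n n"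
  by (simp add: mono_mat_def)

definition Psi_coeff :: "nat \<Rightarrow> nat \<Rightarrow> laurent" where
  "Psi_coeff i = (\<lambda>r. if r = i - 1 then var_t else if r = i then var_b else 1)"

definition Psi_perm :: "nat \<Rightarrow> nat \<Rightarrow> nat" where
  "Psi_perm i = (\<lambda>r. if r = i - 1 then i else if r = i then i - 1 else r)"

lemma Psi_gen_mono:
  assumes "i \<in> {1..<n}"
  shows "Psi_gen n i = mono_mat n (Psi_perm i) (Psi_coeff i)"
proof -
  obtain j where j: "i = Suc j" and jn: "Suc j < n"
    using assms by (cases i) auto
  define B :: "laurent mat" where "B = mat_of_rows_list 2 [[0, var_t], [var_b, 0]]"
  have B: "dim_row B = 2" "dim_col B = 2" "B $$ (0, 0) = 0" "B $$ (0, Suc 0) = var_t"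
      "B $$ (Suc 0, 0) = var_b" "B $$ (Suc 0, Suc 0) = 0"
    by (simp_all add: B_def mat_of_rows_list_def)
  define D where "D = diag_block_mat [B, 1\<^sub>m (n - i - 1)]"
  have D: "dim_row D = n - j" "dim_col D = n - j"
    using jn by (simp_all add: D_def Let_def B j)
  have D_entry: "D $$ (r, c) = (if r < 2 then if c < 2 then B $$ (r, c) else 0
      else if r = c then 1 else 0)" if "r < n - j" "c < n - j" for r c
  proof -
    have "D = four_block_mat B (0\<^sub>m 2 (n - i - 1)) (0\<^sub>m (n - i - 1) 2) (1\<^sub>m (n - i - 1))"
      unfolding D_def diag_block_mat.simps(2)[of B] diag_block_mat_singleton
      by (simp add: Let_def B)
    thus ?thesis using that jn by (cases "r < 2"; cases "c < 2"; simp add: B j; arith?)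
  qed
  have gen: "Psi_gen n i = four_block_mat (1\<^sub>m j) (0\<^sub>m j (n - j)) (0\<^sub>m (n - j) j) D"
    unfolding Psi_gen_def B_def[symmetric] diag_block_mat.simps(2)[of "1\<^sub>m (i - 1)"] D_def[symmetric]
    by (simp add: Let_def D j)
  have entry: "Psi_gen n i $$ (r, c) = (if r < j then if r = c then 1 else 0
      else if c < j then 0 else D $$ (r - j, c - j))" if "r < n" "c < n" for r c
    using that jn by (simp add: gen D)
  show ?thesis
  proof (rule eq_matI)
    fix r c
    assume "r < dim_row (mono_mat n (Psi_perm i) (Psi_coeff i))"
      "c < dim_col (mono_mat n (Psi_perm i) (Psi_coeff i))"
    hence rc: "r < n" "c < n" by (auto simp: mono_mat_def)
    have rhs: "mono_mat n (Psi_perm i) (Psi_coeff i) $$ (r, c) =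
        (if c = Psi_perm i r then Psi_coeff i r else 0)"
      using rc by (simp add: mono_mat_def)
    have cases4: "m < j \<or> m = j \<or> m = Suc j \<or> (\<exists>k. m = Suc (Suc (j + k)))" for m
      by presburger
    show "Psi_gen n i $$ (r, c) = mono_mat n (Psi_perm i) (Psi_coeff i) $$ (r, c)"
      unfolding rhs entry[OF rc] using cases4[of r] cases4[of c] rc jn
      by (elim disjE exE) (simp_all add: D_entry B Psi_perm_def Psi_coeff_def j)
  qed (use jn in \<open>simp_all add: gen D mono_mat_def\<close>)
qed

definition Psi_inv_coeff :: "nat \<Rightarrow> nat \<Rightarrow> laurent" where
  "Psi_inv_coeff i = (\<lambda>r. if r = i - 1 then Poly_Mapping.single (0, - 1) 1
     else if r = i then Poly_Mapping.single (- 1, 0) 1 else 1)"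

lemma var_inverses:
  "var_t * Poly_Mapping.single (- 1, 0) 1 = 1" "Poly_Mapping.single (- 1, 0) 1 * var_t = 1"
  "var_b * Poly_Mapping.single (0, - 1) 1 = 1" "Poly_Mapping.single (0, - 1) 1 * var_b = 1"
  by (simp_all add: var_t_def var_b_def mult_single flip: zero_prod_def)

lemma Psi_perm_less: "i \<in> {1..<n} \<Longrightarrow> \<forall>r<n. Psi_perm i r < n"
  by (auto simp: Psi_perm_def)

lemma Psi_gen_inverse:
  assumes "i \<in> {1..<n}"
  shows "Psi_gen n i * mono_mat n (Psi_perm i) (Psi_inv_coeff i) = 1\<^sub>m n"
    and "mono_mat n (Psi_perm i) (Psi_inv_coeff i) * Psi_gen n i = 1\<^sub>m n"
  unfolding Psi_gen_mono[OF assms] mono_mat_mult[OF Psi_perm_less[OF assms]] mono_mat_one[symmetric]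
  by (use assms in \<open>intro mono_mat_cong; auto simp: Psi_perm_def Psi_coeff_def Psi_inv_coeff_def var_inverses\<close>)+

lemma GL_simps:
  "carrier (GL n) = Units (ring_mat TYPE(laurent) n ())"
  "A \<otimes>\<^bsub>GL n\<^esub> B = A * B"
  "\<one>\<^bsub>GL n\<^esub> = 1\<^sub>m n"
  by (simp_all add: GL_def units_of_def ring_mat_def)

lemma group_GL: "group (GL n)"
proof -
  interpret ring "ring_mat TYPE(laurent) n ()" by (rule ring_mat)
  show ?thesis unfolding GL_def by (rule units_group)
qed

lemma Psi_gen_GL:
  assumes "i \<in> {1..<n}"
  shows "Psi_gen n i \<in> carrier (GL n)"
proof -
  have "Psi_gen n i \<in> carrier_mat n n"
    by (simp add: Psi_gen_mono[OF assms] mono_mat_carrier)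
  thus ?thesis
    using Psi_gen_inverse[OF assms] mono_mat_carrier
    unfolding GL_simps Units_def ring_mat_simps by blast
qed

lemma Psi_gen_braid:
  assumes "i \<in> {1..<n}" "i + 1 \<in> {1..<n}"
  shows "Psi_gen n i * (Psi_gen n (i + 1) * Psi_gen n i) =
    Psi_gen n (i + 1) * (Psi_gen n i * Psi_gen n (i + 1))"
proof -
  note less = Psi_perm_less[OF assms(1)] Psi_perm_less[OF assms(2)]
  show ?thesis
    unfolding Psi_gen_mono[OF assms(1)] Psi_gen_mono[OF assms(2)]
      mono_mat_mult[OF less(1)] mono_mat_mult[OF less(2)]
    using assms(1) by (intro mono_mat_cong) (auto simp: Psi_perm_def Psi_coeff_def mult_ac)
qed

lemma Psi_gen_commute:
  assumes "i \<in> {1..<n}" "j \<in> {1..<n}" "\<bar>int i - int j\<bar> \<ge> 2"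
  shows "Psi_gen n i * Psi_gen n j = Psi_gen n j * Psi_gen n i"
proof -
  note less = Psi_perm_less[OF assms(1)] Psi_perm_less[OF assms(2)]
  obtain k l where kl: "i = Suc k" "j = Suc l"
    using assms(1,2) by (cases i; cases j) auto
  hence ne: "k \<noteq> l" "l \<noteq> k" "k \<noteq> Suc l" "l \<noteq> Suc k" "Suc l \<noteq> k" "Suc k \<noteq> l"
    using assms(3) by auto
  show ?thesis
    unfolding Psi_gen_mono[OF assms(1)] Psi_gen_mono[OF assms(2)]
      mono_mat_mult[OF less(1)] mono_mat_mult[OF less(2)]
  proof (intro mono_mat_cong)
    fix r
    consider "r = k" | "r = Suc k" | "r = l" | "r = Suc l" | "r \<notin> {k, Suc k, l, Suc l}"
      by blast
    note cs = this
    show "(Psi_perm j \<circ> Psi_perm i) r = (Psi_perm i \<circ> Psi_perm j) r"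
      by (cases rule: cs) (use ne in \<open>simp_all add: kl Psi_perm_def\<close>)
    show "Psi_coeff i r * Psi_coeff j (Psi_perm i r) = Psi_coeff j r * Psi_coeff i (Psi_perm j r)"
      by (cases rule: cs) (use ne in \<open>simp_all add: kl Psi_perm_def Psi_coeff_def\<close>)
  qed
qed

lemma Psi_letter_GL: "i \<in> {1..<n} \<Longrightarrow> Psi_letter n (i, e) \<in> carrier (GL n)"
  using Psi_gen_GL group.inv_closed[OF group_GL] by (simp add: Psi_letter_def)

lemma Psi_word_GL: "w \<in> braid_words n \<Longrightarrow> Psi_word n w \<in> carrier (GL n)"
proof (induction w)
  case Nil
  show ?case using group.is_monoid[OF group_GL] by (simp add: Psi_word_def monoid.one_closed)
next
  case (Cons l w)
  interpret G: group "GL n" by (rule group_GL)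
  show ?case using Cons Psi_letter_GL by (cases l) (auto simp: Psi_word_def braid_words_def)
qed

lemma Psi_word_append:
  "u \<in> braid_words n \<Longrightarrow> v \<in> braid_words n \<Longrightarrow>
    Psi_word n (u @ v) = Psi_word n u \<otimes>\<^bsub>GL n\<^esub> Psi_word n v"
proof (induction u)
  case Nil
  interpret G: group "GL n" by (rule group_GL)
  show ?case using Psi_word_GL[OF Nil(2)] by (simp add: Psi_word_def)
next
  case (Cons l u)
  interpret G: group "GL n" by (rule group_GL)
  have u: "u \<in> braid_words n" and l: "Psi_letter n l \<in> carrier (GL n)"
    using Cons.prems Psi_letter_GL by (cases l, auto simp: braid_words_def)+
  show ?case
    using Cons.IH[OF u Cons.prems(2)] Psi_word_GL[OF u] Psi_word_GL[OF Cons.prems(2)] l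
    by (simp add: Psi_word_def G.m_assoc)
qed

lemma Psi_word_eq: "braid_eq n v w \<Longrightarrow> Psi_word n v = Psi_word n w"
proof (induction rule: braid_eq.induct)
  case (append u u' v v')
  thus ?case using braid_eq_words by (simp add: Psi_word_append)
next
  case (cancel i e)
  interpret G: group "GL n" by (rule group_GL)
  show ?case using Psi_gen_GL[OF cancel] by (simp add: Psi_word_def Psi_letter_def)
next
  case (braid i)
  interpret G: group "GL n" by (rule group_GL)
  show ?case
    using Psi_gen_GL[OF braid(1)] Psi_gen_GL[OF braid(2)] Psi_gen_braid[OF braid, folded GL_simps(2)[of n]]
    by (simp add: Psi_word_def Psi_letter_def del: One_nat_def add_Suc_right)
next
  case (commute i j)
  interpret G: group "GL n" by (rule group_GL)
  show ?case
    using Psi_gen_GL[OF commute(1)] Psi_gen_GL[OF commute(2)] Psi_gen_commute[OF commute, folded GL_simps(2)[of n]]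
    by (simp add: Psi_word_def Psi_letter_def)
qed auto

lemma Psi_class:
  assumes "w \<in> braid_words n"
  shows "Psi n (braid_rel n `` {w}) = Psi_word n w"
proof -
  have "Psi_word n ` (braid_rel n `` {w}) = {Psi_word n w}"
  proof
    show "Psi_word n ` (braid_rel n `` {w}) \<subseteq> {Psi_word n w}"
      by (auto simp: braid_rel_def dest: Psi_word_eq)
    have "w \<in> braid_rel n `` {w}" using braid_eq.refl[OF assms] by (simp add: braid_rel_def)
    thus "{Psi_word n w} \<subseteq> Psi_word n ` (braid_rel n `` {w})" by blast
  qed
  thus ?thesis by (simp add: Psi_def)
qed

lemma Psi_hom: "Psi n \<in> hom (braid_group n) (GL n)"
proof (rule homI)
  fix X assume "X \<in> carrier (braid_group n)"
  then obtain w where "X = braid_rel n `` {w}" "w \<in> braid_words n"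
    unfolding carrier_braid_group by blast
  thus "Psi n X \<in> carrier (GL n)" by (simp add: Psi_class Psi_word_GL)
next
  fix X Y assume "X \<in> carrier (braid_group n)" "Y \<in> carrier (braid_group n)"
  then obtain v w where "X = braid_rel n `` {v}" "v \<in> braid_words n"
      "Y = braid_rel n `` {w}" "w \<in> braid_words n"
    unfolding carrier_braid_group by blast
  thus "Psi n (X \<otimes>\<^bsub>braid_group n\<^esub> Y) = Psi n X \<otimes>\<^bsub>GL n\<^esub> Psi n Y"
    by (simp add: mult_braid_group Psi_class Psi_word_append)
qed

lemma Psi_sigma:
  assumes "i \<in> {1..<n}"
  shows "Psi n (sigma n i) = Psi_gen n i"
proof -
  interpret G: group "GL n" by (rule group_GL)
  have "[(i, True)] \<in> braid_words n" using assms by (simp add: braid_words_def)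
  thus ?thesis
    using Psi_gen_GL[OF assms] by (simp add: sigma_def Psi_class Psi_word_def Psi_letter_def)
qed

end

theory Submission
  imports Defs
begin

text \<open>
  Each \<open>\<Psi>(\<sigma>\<^sub>i)\<close> is a monomial matrix, so a word lies in the kernel as soon as its permutation is
  trivial and the exponents of \<open>t\<close> and \<open>b\<close> collected along each strand cancel. That the braids in
  question are nontrivial is seen from the Burau action at parameter \<open>-1\<close> (colourings by the
  dihedral quandle of \<open>\<int>\<close>): \<open>\<sigma>\<^sub>i\<close> replaces the entries \<open>(x, y)\<close> at positions \<open>i\<close> and \<open>i + 1\<close>
  by \<open>(y, 2y - x)\<close>.
\<close>

section \<open>Inverses and squares as explicit words\<close>

lemma inv_braid_group:
  assumes "w \<in> braid_words n"
  shows "inv\<^bsub>braid_group n\<^esub> (braid_rel n `` {w}) = braid_rel n `` {inv_word w}"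
proof -
  interpret G: group "braid_group n" by (rule group_braid_group)
  show ?thesis
  proof (rule G.inv_equality)
    show "braid_rel n `` {inv_word w} \<otimes>\<^bsub>braid_group n\<^esub> braid_rel n `` {w} = \<one>\<^bsub>braid_group n\<^esub>"
      using assms inv_word_words[OF assms] inv_word_left[OF assms]
      by (simp add: one_braid_group mult_braid_group braid_class_eq_iff)
  qed (use assms inv_word_words in \<open>auto simp: carrier_braid_group\<close>)
qed

text \<open>The example braids contain no powers other than 2 and -2, so these two cases suffice to
  write them as classes of words.\<close>

lemma square_braid_group:
  assumes "w \<in> braid_words n"
  shows "(braid_rel n `` {w}) [^]\<^bsub>braid_group n\<^esub> (2::int) = braid_rel n `` {w @ w}"
    and "(braid_rel n `` {w}) [^]\<^bsub>braid_group n\<^esub> (-2::int) = braid_rel n `` {inv_word (w @ w)}"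
proof -
  interpret G: group "braid_group n" by (rule group_braid_group)
  let ?X = "braid_rel n `` {w}"
  have X: "?X \<in> carrier (braid_group n)"
    using assms by (auto simp: carrier_braid_group)
  \<comment> \<open>The integer power is traded for a natural one, which unfolds recursively into a
    product.\<close>
  have "?X [^]\<^bsub>braid_group n\<^esub> (2::int) = ?X [^]\<^bsub>braid_group n\<^esub> (2::nat)"
    using int_pow_int[of "braid_group n" ?X 2] by simp
  also have "\<dots> = ?X \<otimes>\<^bsub>braid_group n\<^esub> ?X"
    using X by (simp add: numeral_2_eq_2)
  finally show sq: "?X [^]\<^bsub>braid_group n\<^esub> (2::int) = braid_rel n `` {w @ w}"
    using assms by (simp add: mult_braid_group)
  show "?X [^]\<^bsub>braid_group n\<^esub> (-2::int) = braid_rel n `` {inv_word (w @ w)}"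
    using G.int_pow_neg[OF X, of 2] sq assms by (simp add: inv_braid_group)
qed

section \<open>The colouring invariant\<close>

text \<open>Colourings live on all of \<open>nat\<close>, so one action serves every
  \<open>n\<close>. Positions are counted from 0, hence \<open>i - 1\<close> and \<open>i\<close>;
  for \<open>i\<close> at least 1 the two equations are mutually inverse.\<close>

fun burau_letter :: "nat \<times> bool \<Rightarrow> (nat \<Rightarrow> int) \<Rightarrow> nat \<Rightarrow> int" where
  "burau_letter (i, True) x = x(i - 1 := x i, i := 2 * x i - x (i - 1))"
| "burau_letter (i, False) x = x(i - 1 := 2 * x (i - 1) - x i, i := x (i - 1))"

definition burau_word :: "braid_word \<Rightarrow> (nat \<Rightarrow> int) \<Rightarrow> nat \<Rightarrow> int" where
  "burau_word = foldr burau_letter"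

lemma burau_word_eq: "braid_eq n v w \<Longrightarrow> burau_word v = burau_word w"
proof (induction rule: braid_eq.induct)
  case (cancel i e)
  thus ?case by (cases e) (auto simp: burau_word_def fun_eq_iff)
next
  case (braid i)
  \<comment> \<open>Both sides send (x, y, z) to (z, 2z - y, 2z - 2y + x).\<close>
  thus ?case by (auto simp: burau_word_def fun_eq_iff)
next
  case (commute i j)
  \<comment> \<open>The letters act on disjoint pairs of positions; since \<open>i\<close> and
    \<open>j\<close> are positive, truncated subtraction merges none of them.\<close>
  hence "i - 1 \<noteq> j" "j - 1 \<noteq> i" "i \<noteq> j" "i - 1 \<noteq> j - 1" by auto
  thus ?case by (auto simp: burau_word_def fun_eq_iff)
qed (auto simp: burau_word_def)

section \<open>Words as monomial matrices\<close>

text \<open>Exponents of t and b in the nonzero entry of row \<open>r\<close>. The inverse of the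
  block with rows (0, t), (b, 0) has rows (0, 1/b), (1/t, 0), so t and b trade rows.\<close>

fun letter_exp :: "nat \<times> bool \<Rightarrow> nat \<Rightarrow> int \<times> int" where
  "letter_exp (i, e) r =
    (if r = i - 1 then (if e then (1, 0) else (0, -1))
     else if r = i then (if e then (0, 1) else (-1, 0)) else (0, 0))"

text \<open>Follows row \<open>r\<close> through the word, as \<open>mono_mat_mult\<close>
  prescribes. The sign of a letter is irrelevant to the move: a transposition is its own
  inverse.\<close>

fun word_exp :: "braid_word \<Rightarrow> nat \<Rightarrow> int \<times> int" where
  "word_exp [] r = (0, 0)"
| "word_exp (l # w) r = letter_exp l r + word_exp w (Psi_perm (fst l) r)"

fun word_perm :: "braid_word \<Rightarrow> nat \<Rightarrow> nat" where
  "word_perm [] r = r"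
| "word_perm (l # w) r = word_perm w (Psi_perm (fst l) r)"

lemma Psi_letter_mono:
  assumes "i \<in> {1..<n}"
  shows "Psi_letter n (i, e) =
    mono_mat n (Psi_perm i) (\<lambda>r. Poly_Mapping.single (letter_exp (i, e) r) 1)"
proof (cases e)
  case True
  thus ?thesis
    by (auto simp: Psi_letter_def Psi_gen_mono[OF assms] Psi_coeff_def var_t_def var_b_def
        simp flip: zero_prod_def intro!: mono_mat_cong)
next
  case False
  interpret G: group "GL n" by (rule group_GL)
  let ?M = "mono_mat n (Psi_perm i) (Psi_inv_coeff i)"
  have "?M \<in> carrier (GL n)"
    using Psi_gen_inverse[OF assms] mono_mat_carrier Psi_gen_mono[OF assms]
    unfolding GL_simps Units_def ring_mat_simps by (metis (mono_tags, lifting) mem_Collect_eq)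
  \<comment> \<open>Inverses in a group are unique, so the explicit inverse matrix is the abstract
    one.\<close>
  hence "inv\<^bsub>GL n\<^esub> (Psi_gen n i) = ?M"
    using Psi_gen_inverse[OF assms] Psi_gen_GL[OF assms]
    by (intro G.inv_equality) (simp_all add: GL_simps(2,3))
  thus ?thesis using False
    by (auto simp: Psi_letter_def Psi_inv_coeff_def simp flip: zero_prod_def intro!: mono_mat_cong)
qed

lemma Psi_word_mono:
  "w \<in> braid_words n \<Longrightarrow>
    Psi_word n w = mono_mat n (word_perm w) (\<lambda>r. Poly_Mapping.single (word_exp w r) 1)"
proof (induction w)
  case Nil
  \<comment> \<open>Read backwards, \<open>zero_prod_def\<close> turns the exponent (0, 0) into 0,
    whose monomial is 1.\<close>
  have "mono_mat n (word_perm []) (\<lambda>r. Poly_Mapping.single (word_exp [] r) 1) = 1\<^sub>m n"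
    unfolding mono_mat_one[symmetric] by (intro mono_mat_cong) (simp_all flip: zero_prod_def)
  thus ?case by (simp only: Psi_word_def foldr.simps id_apply GL_simps)
next
  case (Cons l w)
  obtain i e where l: "l = (i, e)" by force
  have i: "i \<in> {1..<n}" and w: "w \<in> braid_words n"
    using Cons.prems by (auto simp: braid_words_def l)
  have "Psi_word n (l # w) = Psi_letter n l * Psi_word n w"
    by (simp add: Psi_word_def GL_simps)
  also have "\<dots> = mono_mat n (word_perm (l # w)) (\<lambda>r. Poly_Mapping.single (word_exp (l # w) r) 1)"
    unfolding Cons.IH[OF w] l Psi_letter_mono[OF i] mono_mat_mult[OF Psi_perm_less[OF i]]
    by (intro mono_mat_cong) (simp_all add: mult_single)
  finally show ?case .
qed

text \<open>Reduces each example to evaluating its word: the empty word fixes every colouring, so a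
  moved \<open>x\<close> separates \<open>w\<close> from it, while \<open>triv\<close> makes the
  monomial matrix the identity.\<close>

lemma nontrivial_in_kernel:
  assumes w: "w \<in> braid_words n"
    and triv: "\<And>r. r < n \<Longrightarrow> word_perm w r = r" "\<And>r. r < n \<Longrightarrow> word_exp w r = (0, 0)"
    and x: "burau_word w x \<noteq> x"
  shows "braid_rel n `` {w} \<noteq> \<one>\<^bsub>braid_group n\<^esub> \<and>
    braid_rel n `` {w} \<in> kernel (braid_group n) (GL n) (Psi n)"
proof
  have "\<not> braid_eq n w []"
    using burau_word_eq[of n w "[]"] x by (auto simp: burau_word_def)
  thus "braid_rel n `` {w} \<noteq> \<one>\<^bsub>braid_group n\<^esub>"
    using w by (simp add: one_braid_group braid_class_eq_iff)
  have "Psi_word n w = 1\<^sub>m n"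
    unfolding Psi_word_mono[OF w] mono_mat_one[symmetric]
    using triv by (intro mono_mat_cong) (simp_all flip: zero_prod_def)
  thus "braid_rel n `` {w} \<in> kernel (braid_group n) (GL n) (Psi n)"
    using w by (auto simp: kernel_def carrier_braid_group Psi_class GL_simps)
qed

abbreviation delta :: "nat \<Rightarrow> nat \<Rightarrow> int" where
  "delta j \<equiv> (\<lambda>_. 0)(j := 1)"

section \<open>The explicit kernel elements\<close>

text \<open>On the first three rows \<sigma>_1 \<sigma>_2^-1 acts as a 3-cycle with entries t/b, b
  and 1/t. Its cube is therefore scalar there, with factor their product 1.\<close>

lemma kernel_12_cubed:
  assumes "n \<ge> 3"
  defines "w \<equiv> [(1, True), (2, False), (1, True), (2, False), (1, True), (2, False)]"
  shows "braid_rel n `` {w} \<noteq> \<one>\<^bsub>braid_group n\<^esub> \<and>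
    braid_rel n `` {w} \<in> kernel (braid_group n) (GL n) (Psi n)"
proof (rule nontrivial_in_kernel)
  show "w \<in> braid_words n" using assms by (auto simp: braid_words_def)
  fix r :: nat
  \<comment> \<open>No letter touches a row beyond 3, so the last case needs no bound on
    \<open>r\<close>.\<close>
  consider "r = 0" | "r = 1" | "r = 2" | "r = 3" | "r \<ge> 4" by arith
  then show "word_perm w r = r" "word_exp w r = (0, 0)"
    by (cases; simp add: w_def Psi_perm_def)+
next
  \<comment> \<open>The entry at 0 changes from 1 to -7.\<close>
  have "burau_word w (delta 0) 0 \<noteq> delta 0 0" by (simp add: w_def burau_word_def)
  thus "burau_word w (delta 0) \<noteq> delta 0" by metis
qed

text \<open>With X = \<sigma>_1^-1 \<sigma>_2^2 \<sigma>_1^-1 and Y = \<sigma>_2^-1 \<sigma>_1^2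
  \<sigma>_2^-1 one has \<alpha> = XY and \<beta> = YX, so the word is a commutator; X and Y have
  diagonal images, which commute.\<close>

lemma kernel_alpha_beta:
  defines "w \<equiv> [(1, False), (2, True), (2, True), (1, False), (2, False), (1, True), (1, True), (2, False),
    (1, True), (2, False), (2, False), (1, True), (2, True), (1, False), (1, False), (2, True)]"
  shows "braid_rel 3 `` {w} \<noteq> \<one>\<^bsub>braid_group 3\<^esub> \<and>
    braid_rel 3 `` {w} \<in> kernel (braid_group 3) (GL 3) (Psi 3)"
proof (rule nontrivial_in_kernel)
  show "w \<in> braid_words 3" by (auto simp: w_def braid_words_def)
  fix r :: nat
  consider "r = 0" | "r = 1" | "r = 2" | "r = 3" | "r \<ge> 4" by arith
  then show "word_perm w r = r" "word_exp w r = (0, 0)"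
    by (cases; simp add: w_def Psi_perm_def)+
next
  \<comment> \<open>Here the entry at 0 becomes 73.\<close>
  have "burau_word w (delta 0) 0 \<noteq> delta 0 0" by (simp add: w_def burau_word_def)
  thus "burau_word w (delta 0) \<noteq> delta 0" by metis
qed

text \<open>The word is the commutator of \<sigma>_1^2 \<sigma>_3^2 and \<sigma>_2, and the image of
  \<sigma>_1^2 \<sigma>_3^2 is the scalar matrix with factor tb.\<close>

lemma kernel_B4:
  defines "w \<equiv> [(1, True), (1, True), (3, True), (3, True), (2, True),
    (3, False), (3, False), (1, False), (1, False), (2, False)]"
  shows "braid_rel 4 `` {w} \<noteq> \<one>\<^bsub>braid_group 4\<^esub> \<and>
    braid_rel 4 `` {w} \<in> kernel (braid_group 4) (GL 4) (Psi 4)"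
proof (rule nontrivial_in_kernel)
  show "w \<in> braid_words 4" by (auto simp: w_def braid_words_def)
  fix r :: nat
  consider "r = 0" | "r = 1" | "r = 2" | "r = 3" | "r \<ge> 4" by arith
  then show "word_perm w r = r" "word_exp w r = (0, 0)"
    by (cases; simp add: w_def Psi_perm_def)+
next
  \<comment> \<open>Here the entry at 0 becomes -3.\<close>
  have "burau_word w (delta 0) 0 \<noteq> delta 0 0" by (simp add: w_def burau_word_def)
  thus "burau_word w (delta 0) \<noteq> delta 0" by metis
qed

theorem mainTheorem3:
  shows "(\<forall>n\<ge>3.
      kernel (braid_group n) (GL n) (Psi n) \<noteq> {\<one>\<^bsub>braid_group n\<^esub>} \<and>
      \<not> inj_on (Psi n) (carrier (braid_group n)))
    \<and> (let G = braid_group 3; s1 = sigma 3 1; s2 = sigma 3 2;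
           x = s1 \<otimes>\<^bsub>G\<^esub> inv\<^bsub>G\<^esub> s2 \<otimes>\<^bsub>G\<^esub> s1 \<otimes>\<^bsub>G\<^esub> inv\<^bsub>G\<^esub> s2 \<otimes>\<^bsub>G\<^esub> s1 \<otimes>\<^bsub>G\<^esub> inv\<^bsub>G\<^esub> s2
       in x \<noteq> \<one>\<^bsub>G\<^esub> \<and> x \<in> kernel G (GL 3) (Psi 3))
    \<and> (let G = braid_group 3; s1 = sigma 3 1; s2 = sigma 3 2;
           \<alpha> = inv\<^bsub>G\<^esub> s1 \<otimes>\<^bsub>G\<^esub> s2 [^]\<^bsub>G\<^esub> (2::int) \<otimes>\<^bsub>G\<^esub> inv\<^bsub>G\<^esub> s1 \<otimes>\<^bsub>G\<^esub>
               inv\<^bsub>G\<^esub> s2 \<otimes>\<^bsub>G\<^esub> s1 [^]\<^bsub>G\<^esub> (2::int) \<otimes>\<^bsub>G\<^esub> inv\<^bsub>G\<^esub> s2;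
           \<beta> = inv\<^bsub>G\<^esub> s2 \<otimes>\<^bsub>G\<^esub> s1 [^]\<^bsub>G\<^esub> (2::int) \<otimes>\<^bsub>G\<^esub> inv\<^bsub>G\<^esub> s2 \<otimes>\<^bsub>G\<^esub>
               inv\<^bsub>G\<^esub> s1 \<otimes>\<^bsub>G\<^esub> s2 [^]\<^bsub>G\<^esub> (2::int) \<otimes>\<^bsub>G\<^esub> inv\<^bsub>G\<^esub> s1;
           x = \<alpha> \<otimes>\<^bsub>G\<^esub> inv\<^bsub>G\<^esub> \<beta>
       in x \<noteq> \<one>\<^bsub>G\<^esub> \<and> x \<in> kernel G (GL 3) (Psi 3))
    \<and> (let G = braid_group 4; s1 = sigma 4 1; s2 = sigma 4 2; s3 = sigma 4 3;
           x = s1 [^]\<^bsub>G\<^esub> (2::int) \<otimes>\<^bsub>G\<^esub> s3 [^]\<^bsub>G\<^esub> (2::int) \<otimes>\<^bsub>G\<^esub> s2 \<otimes>\<^bsub>G\<^esub>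
               s3 [^]\<^bsub>G\<^esub> (- 2::int) \<otimes>\<^bsub>G\<^esub> s1 [^]\<^bsub>G\<^esub> (- 2::int) \<otimes>\<^bsub>G\<^esub> inv\<^bsub>G\<^esub> s2
       in x \<noteq> \<one>\<^bsub>G\<^esub> \<and> x \<in> kernel G (GL 4) (Psi 4))"
proof (intro conjI)
  show "\<forall>n\<ge>3. kernel (braid_group n) (GL n) (Psi n) \<noteq> {\<one>\<^bsub>braid_group n\<^esub>} \<and>
      \<not> inj_on (Psi n) (carrier (braid_group n))"
  proof (intro allI impI)
    fix n :: nat
    assume "n \<ge> 3"
    interpret group_hom "braid_group n" "GL n" "Psi n"
      using group_braid_group group_GL Psi_hom by (simp add: group_hom_def group_hom_axioms_def)
    \<comment> \<open>The same word in \<sigma>_1 and \<sigma>_2 is a witness for every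
      \<open>n\<close> from 3 on.\<close>
    have "kernel (braid_group n) (GL n) (Psi n) \<noteq> {\<one>\<^bsub>braid_group n\<^esub>}"
      using kernel_12_cubed[OF \<open>n \<ge> 3\<close>] by blast
    thus "kernel (braid_group n) (GL n) (Psi n) \<noteq> {\<one>\<^bsub>braid_group n\<^esub>} \<and>
        \<not> inj_on (Psi n) (carrier (braid_group n))"
      using inj_iff_trivial_ker by blast
  qed
  have words: "(i, e) # w \<in> braid_words n \<longleftrightarrow> 1 \<le> i \<and> i < n \<and> w \<in> braid_words n" for i e w n
    by (simp add: braid_words_def)
  \<comment> \<open>These rules collapse each product of generators, inverses and powers to the
    class of a single word, namely the \<open>w\<close> of the matching lemma.\<close>
  note to_word = Let_def sigma_def words inv_braid_group square_braid_group mult_braid_group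
    inv_word_def
  show "let G = braid_group 3; s1 = sigma 3 1; s2 = sigma 3 2;
           x = s1 \<otimes>\<^bsub>G\<^esub> inv\<^bsub>G\<^esub> s2 \<otimes>\<^bsub>G\<^esub> s1 \<otimes>\<^bsub>G\<^esub> inv\<^bsub>G\<^esub> s2 \<otimes>\<^bsub>G\<^esub> s1 \<otimes>\<^bsub>G\<^esub> inv\<^bsub>G\<^esub> s2
       in x \<noteq> \<one>\<^bsub>G\<^esub> \<and> x \<in> kernel G (GL 3) (Psi 3)"
    using kernel_12_cubed[of 3] by (simp add: to_word)
  show "let G = braid_group 3; s1 = sigma 3 1; s2 = sigma 3 2;
           \<alpha> = inv\<^bsub>G\<^esub> s1 \<otimes>\<^bsub>G\<^esub> s2 [^]\<^bsub>G\<^esub> (2::int) \<otimes>\<^bsub>G\<^esub> inv\<^bsub>G\<^esub> s1 \<otimes>\<^bsub>G\<^esub>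
               inv\<^bsub>G\<^esub> s2 \<otimes>\<^bsub>G\<^esub> s1 [^]\<^bsub>G\<^esub> (2::int) \<otimes>\<^bsub>G\<^esub> inv\<^bsub>G\<^esub> s2;
           \<beta> = inv\<^bsub>G\<^esub> s2 \<otimes>\<^bsub>G\<^esub> s1 [^]\<^bsub>G\<^esub> (2::int) \<otimes>\<^bsub>G\<^esub> inv\<^bsub>G\<^esub> s2 \<otimes>\<^bsub>G\<^esub>
               inv\<^bsub>G\<^esub> s1 \<otimes>\<^bsub>G\<^esub> s2 [^]\<^bsub>G\<^esub> (2::int) \<otimes>\<^bsub>G\<^esub> inv\<^bsub>G\<^esub> s1;
           x = \<alpha> \<otimes>\<^bsub>G\<^esub> inv\<^bsub>G\<^esub> \<beta>
       in x \<noteq> \<one>\<^bsub>G\<^esub> \<and> x \<in> kernel G (GL 3) (Psi 3)"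
    using kernel_alpha_beta by (simp add: to_word)
  show "let G = braid_group 4; s1 = sigma 4 1; s2 = sigma 4 2; s3 = sigma 4 3;
           x = s1 [^]\<^bsub>G\<^esub> (2::int) \<otimes>\<^bsub>G\<^esub> s3 [^]\<^bsub>G\<^esub> (2::int) \<otimes>\<^bsub>G\<^esub> s2 \<otimes>\<^bsub>G\<^esub>
               s3 [^]\<^bsub>G\<^esub> (- 2::int) \<otimes>\<^bsub>G\<^esub> s1 [^]\<^bsub>G\<^esub> (- 2::int) \<otimes>\<^bsub>G\<^esub> inv\<^bsub>G\<^esub> s2
       in x \<noteq> \<one>\<^bsub>G\<^esub> \<and> x \<in> kernel G (GL 4) (Psi 4)"
    using kernel_B4 by (simp add: to_word)
qed

end
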